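(* Let $p$ be a prime, let $n\geq 2$ be an integer, and for $c\in\mathbb{F}_p$ let $h_c:\mathbb{F}_p\to\mathbb{F}_p$, $h_c(x)=x^n+c$. If $n$ is odd, then the reduced periodic point diagram of $h_c$ over $\mathbb{F}_p$ is symmetric with respect to the line $j=-i \bmod p$. That is, if $a$ is an $r$-periodic point of $h_c$, then $-a$ is an $r$-periodic point of $h_{-c}$ (where $-a$ and $-c$ are the additive inverses of $a$ and $c$ modulo $p$).
   Context: All arithmetic is in the prime field $\mathbb{F}_p=\{0,1,\ldots,p-1\}$ with addition and multiplication modulo $p$. For a map $h$, $h^r$ denotes its $r$-fold composition. A point $a\in\mathbb{F}_p$ is a periodic point of $h_c$ if $h_c^r(a)=a$ for some positive integer $r$; the smallest such $r$ is the period of $a$, and $a$ is then called an $r$-periodic point of $h_c$. The periodic point diagram of $h_c$ over $\mathbb{F}_p$ has the parameter values $c\in\mathbb{F}_p$ on the horizontal axis and the points $x\in\mathbb{F}_p$ on the vertical axis; the position $(i,j)$ (column $c=i$, row $x=j$) is marked exactly when $j$ is a periodic point of $h_i$. The reduced periodic point diagram is obtained from it by removing the column $c=0$ and the row $x=0$.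
   Formalization: Symmetry about the line j = -i is read as invariance under (i,j) -> (-i,-j), as the "That is" sentence says; literal reflection (i,j) -> (-j,-i) fails: for p=7, n=3, 3 is periodic for h_2, but 5 is not periodic for h_4. *)

theory Defs
  imports "HOL-Number_Theory.Residues"
begin

text \<open>
  The prime field is the library ring \<open>residue_ring (int p)\<close>, with carrier
  \<open>{0..int p - 1}\<close> and arithmetic modulo \<open>p\<close>.
\<close>

abbreviation Fp :: "nat \<Rightarrow> int ring"
  where "Fp p \<equiv> residue_ring (int p)"

definition h :: "nat \<Rightarrow> nat \<Rightarrow> int \<Rightarrow> int \<Rightarrow> int"
  where "h p n c x = x [^]\<^bsub>Fp p\<^esub> n \<oplus>\<^bsub>Fp p\<^esub> c"

definition periodic_point :: "('a \<Rightarrow> 'a) \<Rightarrow> 'a \<Rightarrow> bool"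
  where "periodic_point f a \<longleftrightarrow> (\<exists>r>0. (f ^^ r) a = a)"

text \<open>Only meaningful when \<open>a\<close> is a periodic point of \<open>f\<close>.\<close>

definition period :: "('a \<Rightarrow> 'a) \<Rightarrow> 'a \<Rightarrow> nat"
  where "period f a = (LEAST r. r > 0 \<and> (f ^^ r) a = a)"

definition r_periodic_point :: "nat \<Rightarrow> ('a \<Rightarrow> 'a) \<Rightarrow> 'a \<Rightarrow> bool"
  where "r_periodic_point r f a \<longleftrightarrow> periodic_point f a \<and> period f a = r"

text \<open>Pairs are (column, row) = (parameter, point).\<close>

definition periodic_point_diagram :: "nat \<Rightarrow> nat \<Rightarrow> (int \<times> int) set"
  where "periodic_point_diagram p n =
    {(i, j). i \<in> carrier (Fp p) \<and> j \<in> carrier (Fp p) \<and> periodic_point (h p n i) j}"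

definition reduced_periodic_point_diagram :: "nat \<Rightarrow> nat \<Rightarrow> (int \<times> int) set"
  where "reduced_periodic_point_diagram p n =
    {(i, j) \<in> periodic_point_diagram p n. i \<noteq> \<zero>\<^bsub>Fp p\<^esub> \<and> j \<noteq> \<zero>\<^bsub>Fp p\<^esub>}"

text \<open>
  Symmetry "with respect to the line \<open>j = -i\<close>" in the sense in which it is used for
  periodic point diagrams: \<open>(i, j)\<close> corresponds to \<open>(-i, -j)\<close>. This is not the
  Euclidean reflection \<open>(i, j) \<mapsto> (-j, -i)\<close> in that line, which does not preserve the
  diagrams: for \<open>p = 7\<close>, \<open>n = 3\<close> the position \<open>(2, 3)\<close> is marked but \<open>(4, 5)\<close> is not.
\<close>

definition symmetric_wrt_neg_line :: "nat \<Rightarrow> (int \<times> int) set \<Rightarrow> bool"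
  where "symmetric_wrt_neg_line p D \<longleftrightarrow>
    (\<lambda>(i, j). (\<ominus>\<^bsub>Fp p\<^esub> i, \<ominus>\<^bsub>Fp p\<^esub> j)) ` D = D"

end

theory Submission
  imports Defs
begin

text \<open>
  For odd \<open>n\<close> the power map commutes with negation, so \<open>h\<^bsub>-c\<^esub>(-x) = -h\<^bsub>c\<^esub>(x)\<close>: negation
  conjugates \<open>h\<^bsub>c\<^esub>\<close> to \<open>h\<^bsub>-c\<^esub>\<close>. A conjugacy carries the \<open>r\<close>-th iterate of one map to the
  \<open>r\<close>-th iterate of the other, so \<open>x\<close> returns to itself after \<open>r\<close> steps exactly when
  \<open>-x\<close> does. Hence periodicity and the exact period are preserved
  (\<open>periodic_point_h_minus\<close>, \<open>period_h_minus\<close>). Negation sends nonzero classes to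
  nonzero classes, so it maps the reduced diagram into itself; being an involution, it
  maps the diagram onto itself.
\<close>

lemma funpow_closed:
  assumes "\<And>x. x \<in> S \<Longrightarrow> f x \<in> S" and "a \<in> S"
  shows "(f ^^ r) a \<in> S"
  using assms by (induction r) auto

lemma funpow_conjugate:
  assumes closed: "\<And>x. x \<in> S \<Longrightarrow> f x \<in> S"
    and conj: "\<And>x. x \<in> S \<Longrightarrow> f' (g x) = g (f x)"
    and a: "a \<in> S"
  shows "(f' ^^ r) (g a) = g ((f ^^ r) a)"
  by (induction r) (simp_all add: conj funpow_closed[of S f, OF closed a])

text \<open>
  Injectivity of the conjugating map is what makes the return times agree: without it
  the image of \<open>a\<close> could return earlier than \<open>a\<close>.
\<close>

lemma funpow_fixed_conjugate_iff:
  assumes closed: "\<And>x. x \<in> S \<Longrightarrow> f x \<in> S"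
    and conj: "\<And>x. x \<in> S \<Longrightarrow> f' (g x) = g (f x)"
    and inj: "inj_on g S" and a: "a \<in> S"
  shows "(f' ^^ r) (g a) = g a \<longleftrightarrow> (f ^^ r) a = a"
  using funpow_conjugate[of S f f' g, OF closed conj a] funpow_closed[of S f, OF closed a]
    inj_on_eq_iff[OF inj _ a] by simp

lemma
  assumes closed: "\<And>x. x \<in> S \<Longrightarrow> f x \<in> S"
    and conj: "\<And>x. x \<in> S \<Longrightarrow> f' (g x) = g (f x)"
    and inj: "inj_on g S" and a: "a \<in> S"
  shows periodic_point_conjugate: "periodic_point f' (g a) \<longleftrightarrow> periodic_point f a"
    and period_conjugate: "period f' (g a) = period f a"
  unfolding periodic_point_def period_def
  by (simp_all add: funpow_fixed_conjugate_iff[of S f f' g, OF closed conj inj a])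

lemma (in cring) minus_pow_odd:
  assumes "x \<in> carrier R" and "odd (n :: nat)"
  shows "(\<ominus> x) [^] n = \<ominus> (x [^] n)"
proof -
  obtain k where n: "n = Suc (2 * k)"
    using \<open>odd n\<close> by (auto elim: oddE)
  have "(\<ominus> x) [^] (2 * k) = x [^] (2 * k)"
    using assms(1) by (induction k) (simp_all add: l_minus r_minus m_assoc)
  then show ?thesis
    using assms(1) by (simp add: n r_minus)
qed

context residues_prime
begin

lemma h_closed:
  assumes "c \<in> carrier R" and "x \<in> carrier R"
  shows "h p n c x \<in> carrier R"
  using assms unfolding h_def R_m_def[symmetric] by simp

lemma h_minus:
  assumes "c \<in> carrier R" and "x \<in> carrier R" and "odd n"
  shows "h p n (\<ominus> c) (\<ominus> x) = \<ominus> (h p n c x)"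
  using assms unfolding h_def R_m_def[symmetric]
  by (simp add: minus_pow_odd minus_add)

lemma
  assumes "c \<in> carrier R" and "a \<in> carrier R" and "odd n"
  shows periodic_point_h_minus:
      "periodic_point (h p n (\<ominus> c)) (\<ominus> a) \<longleftrightarrow> periodic_point (h p n c) a"
    and period_h_minus: "period (h p n (\<ominus> c)) (\<ominus> a) = period (h p n c) a"
proof -
  have inj: "inj_on (\<lambda>x. \<ominus> x) (carrier R)"
    by (metis inj_onI minus_minus)
  note conjugacy = h_closed[OF assms(1)] h_minus[OF assms(1) _ assms(3)] inj assms(2)
  show "periodic_point (h p n (\<ominus> c)) (\<ominus> a) \<longleftrightarrow> periodic_point (h p n c) a"
    by (rule periodic_point_conjugate[of "carrier R"]) (use conjugacy in auto)
  show "period (h p n (\<ominus> c)) (\<ominus> a) = period (h p n c) a"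
    by (rule period_conjugate[of "carrier R"]) (use conjugacy in auto)
qed

lemma symmetric_reduced_diagram:
  assumes "odd n"
  shows "symmetric_wrt_neg_line p (reduced_periodic_point_diagram p n)"
proof -
  define D where "D = reduced_periodic_point_diagram p n"
  define neg where "neg = (\<lambda>(i, j). (\<ominus> i, \<ominus> j))"
  have D_iff: "(i, j) \<in> D \<longleftrightarrow> i \<in> carrier R \<and> j \<in> carrier R \<and>
      periodic_point (h p n i) j \<and> i \<noteq> \<zero> \<and> j \<noteq> \<zero>" for i j
    unfolding D_def reduced_periodic_point_diagram_def periodic_point_diagram_def
      R_m_def[symmetric] by auto
  have neg_D: "neg x \<in> D" if "x \<in> D" for x
  proof (cases x)
    case (Pair i j)
    have "\<ominus> y \<noteq> \<zero>" if "y \<in> carrier R" "y \<noteq> \<zero>" for y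
      using that by (metis minus_minus minus_zero)
    with that show ?thesis
      by (simp add: Pair neg_def D_iff periodic_point_h_minus assms)
  qed
  have "neg (neg x) = x" if "x \<in> D" for x
    using that by (cases x) (simp add: neg_def D_iff)
  \<comment> \<open>An involution that maps a set into itself maps it onto itself.\<close>
  with neg_D have "neg ` D = D"
    by (metis (no_types, lifting) image_eqI image_subsetI subsetI subset_antisym)
  then show ?thesis
    unfolding symmetric_wrt_neg_line_def D_def neg_def R_m_def .
qed

end

theorem theorem4p6:
  fixes p n :: nat
  assumes "prime p" and "n \<ge> 2" and "odd n"
  shows "symmetric_wrt_neg_line p (reduced_periodic_point_diagram p n) \<and>
    (\<forall>c \<in> carrier (Fp p). \<forall>a \<in> carrier (Fp p). \<forall>r.
       r_periodic_point r (h p n c) a \<longrightarrow>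
       r_periodic_point r (h p n (\<ominus>\<^bsub>Fp p\<^esub> c)) (\<ominus>\<^bsub>Fp p\<^esub> a))"
proof -
  interpret residues_prime p "Fp p"
    using assms(1) by unfold_locales (auto simp: prime_gt_1_nat)
  show ?thesis
    using symmetric_reduced_diagram[OF assms(3)] assms(3)
    by (auto simp: r_periodic_point_def periodic_point_h_minus period_h_minus)
qed

end
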